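(* Let $L>0$, $\epsilon>0$, and assume that $\Delta/\Delta_1$ is large enough to ensure that $u=0$ is not the global minimizer of $E_1(\cdot;\epsilon,\Delta)$ in $\mathcal{A}_1$. Then $$\liminf_{\mu\to 0^+}\ \inf\{E_1(v;\epsilon,\Delta)-E_1(0;\epsilon,\Delta):\ v\in\mathcal{A}_1^+ \text{ such that } \mathcal{L}^2(B(v))<\mu\}=0 .$$
   Context: Let $\Omega=[0,L]\times[0,1]\subset\mathbb{R}^2$ with coordinates $(x,y)$. $\mathcal{L}^2$ is two-dimensional Lebesgue measure, and subscripts $x,y$ denote (weak) partial derivatives. For a function $u$ on $\Omega$ put $B(u)=\{(x,y)\in\Omega:\ |u_y(x,y)|\ge 1\}$ and $A(u)=\Omega\setminus B(u)$ and, for $\epsilon>0$, $\Delta\ge0$, define $$E_1(u;\epsilon,\Delta)=\int_\Omega \epsilon^2u_{yy}^2+u_x^2\,d\mathcal{L}^2+\Delta\,\mathcal{L}^2(A(u)).$$ Let $W^{1,2}_p(\Omega,\mathbb{R})=\{u\in W^{1,2}(\Omega,\mathbb{R}): u(x,1)=u(x,0),\ 0\le x\le L\}$ (in the sense of traces), $\mathcal{A}_1=\{u\in W^{1,2}_p(\Omega,\mathbb{R}): u_{yy}\in L^2(\Omega),\ u(0,y)=0 \text{ for } 0\le y\le 1\}$ (boundary values in the sense of traces), and $\mathcal{A}_1^+=\{u\in\mathcal{A}_1:\ \mathcal{L}^2(B(u))>0\}$. The critical well-depth is $\Delta_1=\sup\{\Delta\ge 0:\ u=0 \text{ globally minimizes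 } E_1(\cdot;\epsilon,\Delta) \text{ in } \mathcal{A}_1\}$. *)

theory Defs
  imports "HOL-Analysis.Analysis"
begin

definition L2_on :: "'a::euclidean_space set \<Rightarrow> ('a \<Rightarrow> real) \<Rightarrow> bool" where
  "L2_on S f \<longleftrightarrow>
     f \<in> borel_measurable (lebesgue_on S) \<and> integrable (lebesgue_on S) (\<lambda>x. (f x)\<^sup>2)"

definition locally_integrable_on :: "'a::euclidean_space set \<Rightarrow> ('a \<Rightarrow> real) \<Rightarrow> bool" where
  "locally_integrable_on U f \<longleftrightarrow>
     (\<forall>K. compact K \<and> K \<subseteq> U \<longrightarrow> integrable (lebesgue_on K) f)"

abbreviation partial :: "'a::euclidean_space \<Rightarrow> ('a \<Rightarrow> real) \<Rightarrow> 'a \<Rightarrow> real" where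
  "partial i f \<equiv> (\<lambda>x. frechet_derivative f (at x) i)"

primrec C_k :: "nat \<Rightarrow> ('a::euclidean_space \<Rightarrow> real) \<Rightarrow> bool" where
  "C_k 0 f \<longleftrightarrow> continuous_on UNIV f"
| "C_k (Suc k) f \<longleftrightarrow> (\<forall>x. f differentiable (at x)) \<and> (\<forall>i\<in>Basis. C_k k (partial i f))"

definition test_function :: "'a::euclidean_space set \<Rightarrow> ('a \<Rightarrow> real) \<Rightarrow> bool" where
  "test_function U \<phi> \<longleftrightarrow>
     (\<forall>k. C_k k \<phi>) \<and> compact (closure {x. \<phi> x \<noteq> 0}) \<and> closure {x. \<phi> x \<noteq> 0} \<subseteq> U"

text \<open>
  Sobolev functions are represented by functions defined everywhere. The set \<open>\<Omega>\<close> below is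
  allowed to be closed: weak derivatives only refer to its interior, and for the rectangle used
  here the boundary is a null set.
\<close>

definition has_weak_partial ::
  "'a::euclidean_space set \<Rightarrow> 'a \<Rightarrow> ('a \<Rightarrow> real) \<Rightarrow> ('a \<Rightarrow> real) \<Rightarrow> bool" where
  "has_weak_partial \<Omega> i u g \<longleftrightarrow>
     locally_integrable_on (interior \<Omega>) u \<and> locally_integrable_on (interior \<Omega>) g \<and>
     (\<forall>\<phi>. test_function (interior \<Omega>) \<phi> \<longrightarrow>
        (\<integral>x. u x * partial i \<phi> x \<partial>lebesgue_on \<Omega>) = - (\<integral>x. g x * \<phi> x \<partial>lebesgue_on \<Omega>))"

text \<open>
  A representative of the weak derivative, which is unique up to null sets (and unspecified
  if there is no weak derivative).
\<close>

definition weak_partial :: "'a::euclidean_space set \<Rightarrow> 'a \<Rightarrow> ('a \<Rightarrow> real) \<Rightarrow> 'a \<Rightarrow> real" where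
  "weak_partial \<Omega> i u = (SOME g. has_weak_partial \<Omega> i u g)"

definition W12 :: "'a::euclidean_space set \<Rightarrow> ('a \<Rightarrow> real) set" where
  "W12 \<Omega> = {u. L2_on \<Omega> u \<and> (\<forall>i\<in>Basis. \<exists>g. has_weak_partial \<Omega> i u g \<and> L2_on \<Omega> g)}"

definition W12_sqdist ::
  "'a::euclidean_space set \<Rightarrow> ('a \<Rightarrow> real) \<Rightarrow> ('a \<Rightarrow> real) \<Rightarrow> real" where
  "W12_sqdist \<Omega> u v =
     (\<integral>x. (u x - v x)\<^sup>2 \<partial>lebesgue_on \<Omega>) +
     (\<Sum>i\<in>Basis. \<integral>x. (weak_partial \<Omega> i u x - weak_partial \<Omega> i v x)\<^sup>2 \<partial>lebesgue_on \<Omega>)"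

text \<open>
  The trace operator is the continuous extension to \<open>W12 \<Omega>\<close> of the restriction map
  on the functions in \<open>W12 \<Omega>\<close> that are continuous up to the boundary. Here \<open>\<gamma>\<close> is an arc length
  parametrisation of a side of the boundary by the interval \<open>I\<close>, and \<open>g\<close> is the trace
  of \<open>u\<close> on this side, read in the parameter.
\<close>

definition has_trace ::
  "'a::euclidean_space set \<Rightarrow> (real \<Rightarrow> 'a) \<Rightarrow> real set \<Rightarrow> ('a \<Rightarrow> real) \<Rightarrow> (real \<Rightarrow> real) \<Rightarrow> bool" where
  "has_trace \<Omega> \<gamma> I u g \<longleftrightarrow>
     L2_on I g \<and>
     (\<exists>w. (\<forall>n::nat. w n \<in> W12 \<Omega> \<and> continuous_on (closure \<Omega>) (w n)) \<and>
          (\<lambda>n. W12_sqdist \<Omega> (w n) u) \<longlonglongrightarrow> 0 \<and>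
          (\<lambda>n. \<integral>t. (w n (\<gamma> t) - g t)\<^sup>2 \<partial>lebesgue_on I) \<longlonglongrightarrow> 0)"

definition rect :: "real \<Rightarrow> (real \<times> real) set" where
  "rect L = {0..L} \<times> {0..1}"

abbreviation D_x :: "real \<Rightarrow> (real \<times> real \<Rightarrow> real) \<Rightarrow> real \<times> real \<Rightarrow> real" where
  "D_x L \<equiv> weak_partial (rect L) (1, 0)"

abbreviation D_y :: "real \<Rightarrow> (real \<times> real \<Rightarrow> real) \<Rightarrow> real \<times> real \<Rightarrow> real" where
  "D_y L \<equiv> weak_partial (rect L) (0, 1)"

definition B_set :: "real \<Rightarrow> (real \<times> real \<Rightarrow> real) \<Rightarrow> (real \<times> real) set" where
  "B_set L u = {z \<in> rect L. \<bar>D_y L u z\<bar> \<ge> 1}"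

definition A_set :: "real \<Rightarrow> (real \<times> real \<Rightarrow> real) \<Rightarrow> (real \<times> real) set" where
  "A_set L u = rect L - B_set L u"

definition E1 :: "real \<Rightarrow> real \<Rightarrow> real \<Rightarrow> (real \<times> real \<Rightarrow> real) \<Rightarrow> real" where
  "E1 L \<epsilon> \<Delta> u =
     (\<integral>z. \<epsilon>\<^sup>2 * (D_y L (D_y L u) z)\<^sup>2 + (D_x L u z)\<^sup>2 \<partial>lebesgue_on (rect L)) +
     \<Delta> * measure lebesgue (A_set L u)"

definition W12_per :: "real \<Rightarrow> (real \<times> real \<Rightarrow> real) set" where
  "W12_per L = {u \<in> W12 (rect L).
     \<exists>g. has_trace (rect L) (\<lambda>x. (x, 1)) {0..L} u g \<and>
         has_trace (rect L) (\<lambda>x. (x, 0)) {0..L} u g}"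

definition Adm1 :: "real \<Rightarrow> (real \<times> real \<Rightarrow> real) set" where
  "Adm1 L = {u \<in> W12_per L.
     (\<exists>g. has_weak_partial (rect L) (0, 1) (D_y L u) g \<and> L2_on (rect L) g) \<and>
     has_trace (rect L) (\<lambda>y. (0, y)) {0..1} u (\<lambda>y. 0)}"

definition Adm1_plus :: "real \<Rightarrow> (real \<times> real \<Rightarrow> real) set" where
  "Adm1_plus L = {u \<in> Adm1 L. measure lebesgue (B_set L u) > 0}"

definition zero_minimizes :: "real \<Rightarrow> real \<Rightarrow> real \<Rightarrow> bool" where
  "zero_minimizes L \<epsilon> \<Delta> \<longleftrightarrow> is_arg_min (E1 L \<epsilon> \<Delta>) (\<lambda>v. v \<in> Adm1 L) (\<lambda>z. 0)"

definition Delta1 :: "real \<Rightarrow> real \<Rightarrow> ereal" where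
  "Delta1 L \<epsilon> = (SUP \<Delta>\<in>{\<Delta>. \<Delta> \<ge> 0 \<and> zero_minimizes L \<epsilon> \<Delta>}. ereal \<Delta>)"

text \<open>
  Any well-depth above the critical one, i.e. any ratio of the two exceeding 1, rules out that
  the zero function is a global minimizer.
\<close>

lemma not_zero_minimizes_if_Delta1_less:
  assumes "\<Delta> \<ge> 0" and "Delta1 L \<epsilon> < ereal \<Delta>"
  shows "\<not> zero_minimizes L \<epsilon> \<Delta>"
proof
  assume "zero_minimizes L \<epsilon> \<Delta>"
  with assms(1) have "ereal \<Delta> \<le> Delta1 L \<epsilon>"
    unfolding Delta1_def by (intro SUP_upper) simp
  with assms(2) show False by simp
qed

end

theory Submission
  imports Defs
begin

text \<open>
  Relative to the zero function, a function \<open>v\<close> with \<open>\<L>\<^sup>2(B(v)) < \<mu>\<close> can gain at most \<open>\<Delta> * \<mu>\<close> from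
  the well-depth term, while its elastic energy is nonnegative (\<open>E1_diff_zero_ge\<close>). So the infimum
  is at least \<open>- \<Delta> * \<mu>\<close>, which tends to \<open>0\<close>.

  The other half says that there is no energy barrier: reaching slope \<open>1\<close> on a set of positive
  measure can be made arbitrarily cheap. Place a smooth bump of height of order \<open>h\<close> on a box of
  width \<open>h\<^sup>2\<close> in \<open>x\<close> and height \<open>h\<close> in \<open>y\<close>. Its slope \<open>u\<^sub>y\<close> is of order \<open>1\<close>, while \<open>u\<^sub>x\<close> and
  \<open>u\<^sub>y\<^sub>y\<close> are of order \<open>1 / h\<close> on a set of measure \<open>h\<^sup>3\<close>, so that the elastic energy is of order
  \<open>h\<close> (\<open>concentrated_profiles\<close>). Letting \<open>h\<close> tend to \<open>0\<close> for fixed \<open>\<mu>\<close> shows that the infimum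
  is at most \<open>0\<close>.

  The analytic work lies in connecting this computation with weak derivatives, since the energy is
  defined through an arbitrary choice of weak derivatives. Continuous classical derivatives are weak
  derivatives by integration by parts (\<open>has_weak_partial_x_if_classical\<close>,
  \<open>has_weak_partial_y_if_classical\<close>), and weak derivatives are unique up to null sets
  (\<open>weak_partial_unique\<close>). Uniqueness rests on \<open>fundamental_lemma_calculus_of_variations\<close>, proved
  here by approximating indicator functions of boxes by smooth bumps and then applying
  Lebesgue differentiation. The same bumps provide the profile for the construction.
\<close>

section \<open>Smooth bumps supported in a box\<close>

text \<open>
  For \<open>n = 0\<close> this is the standard smooth function that is flat at the origin. The powers of
  \<open>1 / t\<close> are included because differentiation produces them; together these functions span
  a space closed under differentiation.
\<close>

definition flat :: "nat \<Rightarrow> real \<Rightarrow> real" where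
  "flat n t = (if t \<le> 0 then 0 else (1 / t) ^ n * exp (- (1 / t)))"

lemma flat_nonneg: "0 \<le> flat n t"
  by (simp add: flat_def)

lemma flat_zero_le_one: "flat 0 t \<le> 1"
  by (simp add: flat_def)

text \<open>
  With \<open>y = 1 / t\<close>, a single term of the exponential series gives
  \<open>y ^ (n + 2) \<le> fact (n + 2) * exp y\<close>. Two powers of \<open>t\<close> are kept so that the difference
  quotient at the origin still tends to \<open>0\<close>.
\<close>

lemma flat_bound: "\<bar>flat n t\<bar> \<le> fact (n + 2) * t\<^sup>2"
proof (cases "t \<le> 0")
  case False
  define y where "y = 1 / t"
  have y: "y > 0" using False by (simp add: y_def)
  have "y ^ (n + 2) / fact (n + 2) \<le> exp y"
  proof -
    have "(\<Sum>k\<in>{n+2}. y ^ k /\<^sub>R fact k) \<le> (\<Sum>k. y ^ k /\<^sub>R fact k)"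
      by (rule sum_le_suminf) (use y summable_exp_generic[of y] in auto)
    then show ?thesis by (simp add: exp_def divide_inverse mult.commute del: fact_Suc)
  qed
  then have "y ^ (n + 2) * exp (- y) \<le> fact (n + 2)"
    by (simp add: exp_minus field_simps del: fact_Suc)
  then have "y ^ n * exp (- y) \<le> fact (n + 2) * (1 / y)\<^sup>2"
    using y by (simp add: field_simps power2_eq_square del: fact_Suc)
  moreover have "\<bar>flat n t\<bar> = y ^ n * exp (- y)"
    using y False by (simp add: flat_def y_def)
  moreover have "1 / y = t" by (simp add: y_def)
  ultimately show ?thesis by metis
qed (simp add: flat_def)

lemma DERIV_flat:
  "(flat n has_real_derivative flat (n + 2) t - real n * flat (n + 1) t) (at t)"
proof -
  consider "t < 0" | "t = 0" | "t > 0" by linarith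
  then show ?thesis
  proof cases
    case 1
    have "(flat n has_real_derivative 0) (at t)"
      by (rule has_field_derivative_transform_within_open[where f="\<lambda>_. 0" and S="{..<0}"])
        (use 1 in \<open>auto simp: flat_def\<close>)
    with 1 show ?thesis by (simp add: flat_def)
  next
    case 3
    have inv: "((\<lambda>t. 1 / t) has_real_derivative - ((1 / t)\<^sup>2)) (at t)"
      using 3 by (auto simp: power2_eq_square intro!: derivative_eq_intros)
    have "((\<lambda>t. (1 / t) ^ n * exp (- (1 / t))) has_real_derivative
        flat (n + 2) t - real n * flat (n + 1) t) (at t)"
      by (rule DERIV_cong[OF DERIV_mult[OF DERIV_power[OF inv] DERIV_fun_exp[OF DERIV_minus[OF inv]]]])
        (use 3 in \<open>cases n; simp add: flat_def power2_eq_square algebra_simps\<close>)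
    then show ?thesis
      by (rule has_field_derivative_transform_within_open[where S="{0<..}"])
        (use 3 in \<open>auto simp: flat_def\<close>)
  next
    case 2
    have "(\<lambda>h. flat n h / h) \<midarrow>0\<rightarrow> 0"
    proof (rule Lim_null_comparison)
      show "\<forall>\<^sub>F h in at 0. norm (flat n h / h) \<le> fact (n + 2) * \<bar>h\<bar>"
        unfolding eventually_at_filter
      proof (intro always_eventually allI impI)
        fix h :: real assume "h \<noteq> 0"
        then show "norm (flat n h / h) \<le> fact (n + 2) * \<bar>h\<bar>"
          using flat_bound[of n h]
          by (simp add: abs_divide field_simps power2_eq_square abs_mult_self_eq del: fact_Suc)
      qed
      show "((\<lambda>h. fact (n + 2) * \<bar>h\<bar>) \<longlongrightarrow> 0) (at (0::real))"
        by (auto intro!: tendsto_eq_intros simp del: fact_Suc)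
    qed
    with 2 show ?thesis by (simp add: has_field_derivative_iff flat_def)
  qed
qed

text \<open>
  This set of functions is closed under all partial derivatives, which reduces infinite
  differentiability to one induction on how a function is built, without any explicit formula for
  higher derivatives. It contains products of one-dimensional bumps in all coordinates.
\<close>

inductive_set flat_algebra :: "('a::euclidean_space \<Rightarrow> real) set" where
  const: "(\<lambda>z. c) \<in> flat_algebra"
| flat: "(\<lambda>z. flat n (v \<bullet> z + d)) \<in> flat_algebra"
| add: "f \<in> flat_algebra \<Longrightarrow> g \<in> flat_algebra \<Longrightarrow> (\<lambda>z. f z + g z) \<in> flat_algebra"
| mult: "f \<in> flat_algebra \<Longrightarrow> g \<in> flat_algebra \<Longrightarrow> (\<lambda>z. f z * g z) \<in> flat_algebra"

lemma flat_algebra_derivative: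
  assumes "f \<in> flat_algebra"
  shows "\<exists>D. (\<forall>z. (f has_derivative D z) (at z)) \<and> (\<forall>v. (\<lambda>z. D z v) \<in> flat_algebra)"
  using assms
proof induction
  case (const c)
  show ?case
    by (intro exI[where x="\<lambda>z v. 0"]) (auto intro: flat_algebra.const)
next
  case (flat n v d)
  define D where "D z w = (v \<bullet> w) * (flat (n + 2) (v \<bullet> z + d) + (- real n) * flat (n + 1) (v \<bullet> z + d))"
    for z w
  have "((\<lambda>z. flat n (v \<bullet> z + d)) has_derivative D z) (at z)" for z
    using has_derivative_compose[OF _ DERIV_flat[unfolded has_field_derivative_def],
        of "\<lambda>z. v \<bullet> z + d" "\<lambda>w. v \<bullet> w" z UNIV n]
    by (rule has_derivative_eq_rhs) (auto simp: D_def algebra_simps intro!: derivative_eq_intros)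
  moreover have "(\<lambda>z. D z w) \<in> flat_algebra" for w
    unfolding D_def by (intro flat_algebra.intros)
  ultimately show ?case by blast
next
  case (add f g)
  then obtain F G where *: "\<forall>z. (f has_derivative F z) (at z)" "\<forall>v. (\<lambda>z. F z v) \<in> flat_algebra"
    "\<forall>z. (g has_derivative G z) (at z)" "\<forall>v. (\<lambda>z. G z v) \<in> flat_algebra" by blast
  show ?case
    by (rule exI[where x="\<lambda>z v. F z v + G z v"])
      (use * in \<open>auto intro!: derivative_intros flat_algebra.intros\<close>)
next
  case (mult f g)
  then obtain F G where *: "\<forall>z. (f has_derivative F z) (at z)" "\<forall>v. (\<lambda>z. F z v) \<in> flat_algebra"
    "\<forall>z. (g has_derivative G z) (at z)" "\<forall>v. (\<lambda>z. G z v) \<in> flat_algebra" by blast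
  show ?case
    by (rule exI[where x="\<lambda>z v. f z * G z v + F z v * g z"])
      (use * mult.hyps in \<open>auto intro!: derivative_intros flat_algebra.intros\<close>)
qed

lemma flat_algebra_C_k:
  assumes "f \<in> flat_algebra"
  shows "C_k k f"
  using assms
proof (induction k arbitrary: f)
  case 0
  then obtain D where "\<forall>z. (f has_derivative D z) (at z)"
    using flat_algebra_derivative by blast
  then show ?case
    by (auto intro!: continuous_at_imp_continuous_on has_derivative_continuous)
next
  case (Suc k)
  then obtain D where D: "\<And>z. (f has_derivative D z) (at z)" "\<And>v. (\<lambda>z. D z v) \<in> flat_algebra"
    using flat_algebra_derivative by blast
  have "frechet_derivative f (at z) = D z" for z
    using frechet_derivative_at[OF D(1)] by simp
  then show ?case
    using D Suc.IH by (auto simp: differentiable_def)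
qed

lemma flat_algebra_prod:
  assumes "finite A" "\<And>i. i \<in> A \<Longrightarrow> f i \<in> flat_algebra"
  shows "(\<lambda>z. \<Prod>i\<in>A. f i z) \<in> flat_algebra"
  using assms by (induction) (auto intro: flat_algebra.intros)

text \<open>
  Inside the box each factor equals \<open>exp (- 1 / (m * s))\<close>, where \<open>s\<close> is the distance to one of the
  faces. The parameter \<open>m\<close> leaves the support unchanged and pushes the values inside towards \<open>1\<close>,
  so the bumps approximate the indicator function of the box from within.
\<close>

definition box_bump :: "'a::euclidean_space \<Rightarrow> 'a \<Rightarrow> real \<Rightarrow> 'a \<Rightarrow> real" where
  "box_bump a b m z = (\<Prod>i\<in>Basis. flat 0 (m * ((z - a) \<bullet> i)) * flat 0 (m * ((b - z) \<bullet> i)))"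

lemma box_bump_flat_algebra: "box_bump a b m \<in> flat_algebra"
proof -
  have *: "(\<lambda>z. flat 0 (m * ((z - a) \<bullet> i)) * flat 0 (m * ((b - z) \<bullet> i)))
      = (\<lambda>z. flat 0 ((m *\<^sub>R i) \<bullet> z + (- m * (a \<bullet> i))) * flat 0 ((- m *\<^sub>R i) \<bullet> z + m * (b \<bullet> i)))" for i
    by (simp add: algebra_simps inner_commute)
  show ?thesis
    unfolding box_bump_def[abs_def]
    by (rule flat_algebra_prod) (auto simp only: * finite_Basis intro!: flat_algebra.intros)
qed

lemma box_bump_bounds: "0 \<le> box_bump a b m z" "box_bump a b m z \<le> 1"
  unfolding box_bump_def
  by (auto intro!: prod_nonneg prod_le_1 mult_le_one simp: flat_nonneg flat_zero_le_one)

lemma box_bump_nonzero_iff: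
  assumes "m > 0"
  shows "box_bump a b m z \<noteq> 0 \<longleftrightarrow> z \<in> box a b"
  using assms
  by (auto simp: box_bump_def flat_def mem_box inner_diff_left mult_le_0_iff not_le)

lemma test_function_box_bump:
  assumes "m > 0" "cbox a b \<subseteq> U"
  shows "test_function U (box_bump a b m)"
proof -
  have "{z. box_bump a b m z \<noteq> 0} = box a b"
    using box_bump_nonzero_iff[OF assms(1)] by blast
  moreover have "closure (box a b) \<subseteq> cbox a b"
    by (intro closure_minimal box_subset_cbox closed_cbox)
  moreover have "compact (closure (box a b))"
    by (simp add: bounded_box)
  ultimately show ?thesis
    using assms(2) flat_algebra_C_k[OF box_bump_flat_algebra]
    by (auto simp: test_function_def)
qed

lemma box_bump_tendsto_indicator:
  "(\<lambda>n. box_bump a b (real (Suc n)) z) \<longlonglongrightarrow> indicator (box a b) z"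
proof (cases "z \<in> box a b")
  case True
  have flat: "(\<lambda>n. flat 0 (real (Suc n) * t)) \<longlonglongrightarrow> 1" if "t > 0" for t
  proof -
    have "(\<lambda>n. exp (- (1 / t * (1 / real (Suc n))))) \<longlonglongrightarrow> exp (- (1 / t * 0))"
      by (intro tendsto_intros LIMSEQ_Suc lim_1_over_n)
    moreover have "flat 0 (real (Suc n) * t) = exp (- (1 / t * (1 / real (Suc n))))" for n
      using that by (simp add: flat_def mult_le_0_iff not_le mult.commute)
    ultimately show ?thesis by simp
  qed
  have "(\<lambda>n. box_bump a b (real (Suc n)) z) \<longlonglongrightarrow> (\<Prod>i\<in>(Basis::'a set). 1 * 1)"
    unfolding box_bump_def
    by (intro tendsto_prod tendsto_mult flat) (use True in \<open>auto simp: mem_box inner_diff_left\<close>)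
  with True show ?thesis by simp
next
  case False
  then have "box_bump a b (real (Suc n)) z = 0" for n
    using box_bump_nonzero_iff[of "real (Suc n)" a b z] by simp
  with False show ?thesis by simp
qed

section \<open>The fundamental lemma of the calculus of variations\<close>

text \<open>
  The weak derivatives that enter the energy are selected by a choice operator and are known only
  up to null sets. The next three lemmas allow such a representative to be replaced by a continuous
  one; measurability carries over because Lebesgue measure is complete.
\<close>

lemma borel_measurable_lebesgue_on_spike:
  fixes f g :: "'a::euclidean_space \<Rightarrow> real"
  assumes "S \<in> sets lebesgue" "g \<in> borel_measurable (lebesgue_on S)"
    and "negligible {x \<in> S. f x \<noteq> g x}"
  shows "f \<in> borel_measurable (lebesgue_on S)"
proof -
  have "(\<lambda>x. if x \<in> S then g x else 0) \<in> borel_measurable lebesgue"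
    using assms by (simp add: borel_measurable_if)
  moreover have "AE x in lebesgue. (if x \<in> S then g x else 0) = (if x \<in> S then f x else 0)"
    using assms(3)
    by (intro AE_I'[of "{x \<in> S. f x \<noteq> g x}"]) (auto simp: negligible_iff_null_sets)
  ultimately have "(\<lambda>x. if x \<in> S then f x else 0) \<in> borel_measurable lebesgue"
    by (rule borel_measurable_AE)
  then show ?thesis
    by (rule borel_measurable_if_D)
qed

lemma AE_lebesgue_on_if_negligible:
  assumes "S \<in> sets lebesgue" "negligible {x \<in> S. \<not> P x}"
  shows "AE x in lebesgue_on S. P x"
  using assms
  by (subst AE_restrict_space_iff)
    (auto intro!: AE_I'[of "{x \<in> S. \<not> P x}"] simp: negligible_iff_null_sets)

lemma integral_lebesgue_on_spike:
  fixes f g :: "'a::euclidean_space \<Rightarrow> real"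
  assumes S: "S \<in> sets lebesgue" and g: "integrable (lebesgue_on S) g"
    and N: "negligible {x \<in> S. f x \<noteq> g x}"
  shows "integral\<^sup>L (lebesgue_on S) f = integral\<^sup>L (lebesgue_on S) g"
proof -
  have f: "f \<in> borel_measurable (lebesgue_on S)"
    using borel_measurable_lebesgue_on_spike[OF S _ N] g by auto
  have "AE x in lebesgue_on S. f x = g x"
    using AE_lebesgue_on_if_negligible[OF S N] .
  then show ?thesis
    using integral_cong_AE[OF f] g by auto
qed

text \<open>
  Test with the bumps of the box and let \<open>m\<close> tend to infinity: dominated convergence, with the
  integrable bound \<open>\<bar>f\<bar>\<close> on the closed box, gives the integral over the open box.
\<close>

lemma integral_box_eq_0_if_test_integrals_0:
  fixes f :: "'a::euclidean_space \<Rightarrow> real"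
  assumes f: "locally_integrable_on (interior \<Omega>) f" and \<Omega>: "\<Omega> \<in> sets lebesgue"
    and test: "\<And>\<phi>. test_function (interior \<Omega>) \<phi> \<Longrightarrow> (\<integral>x. f x * \<phi> x \<partial>lebesgue_on \<Omega>) = 0"
    and ab: "cbox a b \<subseteq> interior \<Omega>"
  shows "integral (cbox a b) f = 0"
proof -
  let ?\<phi> = "\<lambda>n::nat. box_bump a b (real (Suc n))"
  let ?M = "lebesgue_on (cbox a b)"
  have int: "integrable ?M f"
    using f ab by (simp add: locally_integrable_on_def)
  have meas: "?\<phi> n \<in> borel_measurable ?M" for n
  proof -
    have "C_k 0 (?\<phi> n)"
      by (intro flat_algebra_C_k box_bump_flat_algebra)
    then have "continuous_on UNIV (?\<phi> n)"
      by simp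
    then have "continuous_on (cbox a b) (?\<phi> n)"
      by (rule continuous_on_subset) simp
    then show ?thesis
      by (rule continuous_imp_measurable_on_sets_lebesgue) simp
  qed
  have zero: "(\<integral>x. f x * ?\<phi> n x \<partial>?M) = 0" for n
  proof -
    have "0 = (\<integral>x. f x * ?\<phi> n x \<partial>lebesgue_on \<Omega>)"
      using test[OF test_function_box_bump[OF _ ab, of "real (Suc n)"]] by (simp del: of_nat_Suc)
    also have "\<dots> = (\<integral>x. (if x \<in> cbox a b then f x * ?\<phi> n x else 0) \<partial>lebesgue_on \<Omega>)"
    proof (intro Bochner_Integration.integral_cong refl)
      fix x
      have "x \<in> cbox a b" if "?\<phi> n x \<noteq> 0"
        using that box_bump_nonzero_iff[of "real (Suc n)" a b x] box_subset_cbox[of a b] by auto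
      then show "f x * ?\<phi> n x = (if x \<in> cbox a b then f x * ?\<phi> n x else 0)"
        by (cases "x \<in> cbox a b") (auto simp del: of_nat_Suc)
    qed
    also have "\<dots> = (\<integral>x. f x * ?\<phi> n x \<partial>?M)"
      using ab interior_subset \<Omega> by (intro Lebesgue_Measure.integral_restrict) auto
    finally show ?thesis by simp
  qed
  have "(\<lambda>n. \<integral>x. f x * ?\<phi> n x \<partial>?M) \<longlonglongrightarrow> (\<integral>x. f x * indicator (box a b) x \<partial>?M)"
  proof (rule integral_dominated_convergence[where w="\<lambda>x. \<bar>f x\<bar>"])
    show "AE x in ?M. (\<lambda>n. f x * ?\<phi> n x) \<longlonglongrightarrow> f x * indicator (box a b) x"
      by (intro always_eventually allI tendsto_intros box_bump_tendsto_indicator)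
    show "AE x in ?M. norm (f x * ?\<phi> n x) \<le> \<bar>f x\<bar>" for n
      using box_bump_bounds[of a b "real (Suc n)"]
      by (intro always_eventually allI) (simp add: abs_mult mult_left_le)
    show "(\<lambda>x. f x * ?\<phi> n x) \<in> borel_measurable ?M" for n
      using int meas by (intro borel_measurable_times) auto
    have "box a b \<in> sets lebesgue" by simp
    then have "(\<lambda>x. indicator (box a b) x :: real) \<in> borel_measurable ?M"
      by (intro measurable_restrict_space1 borel_measurable_indicator)
    then show "(\<lambda>x. f x * indicator (box a b) x) \<in> borel_measurable ?M"
      using int by (intro borel_measurable_times) auto
    show "integrable ?M (\<lambda>x. \<bar>f x\<bar>)"
      using int by (rule integrable_abs)
  qed
  then have "(\<integral>x. f x * indicator (box a b) x \<partial>?M) = 0"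
    unfolding zero by (simp add: LIMSEQ_const_iff)
  moreover have "(\<integral>x. f x * indicator (box a b) x \<partial>?M) = integral\<^sup>L ?M f"
  proof (rule integral_lebesgue_on_spike[OF _ int])
    show "negligible {x \<in> cbox a b. f x * indicator (box a b) x \<noteq> f x}"
      by (rule negligible_subset[OF negligible_frontier_interval[of a b]]) auto
  qed simp
  ultimately show ?thesis
    using lebesgue_integral_eq_integral[OF int] by simp
qed

text \<open>
  By Lebesgue differentiation, almost every value of the function is the limit of its averages over
  small cubes, and these averages vanish. The function is cut off outside the box because the
  differentiation theorem requires integrability over every box.
\<close>

lemma negligible_nonzero_if_cbox_integrals_0:
  fixes f :: "'a::euclidean_space \<Rightarrow> real"
  assumes f: "f integrable_on cbox a b"
    and zero: "\<And>c d. cbox c d \<subseteq> cbox a b \<Longrightarrow> integral (cbox c d) f = 0"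
  shows "negligible {x \<in> cbox a b. f x \<noteq> 0}"
proof -
  define g where "g x = (if x \<in> cbox a b then f x else 0)" for x
  have "g integrable_on cbox c d" for c d
  proof -
    obtain p q where pq: "cbox a b \<inter> cbox c d = cbox p q"
      using Int_interval by blast
    then have "f integrable_on cbox p q"
      by (intro integrable_on_subcbox[OF f]) blast
    then show ?thesis
      unfolding g_def Henstock_Kurzweil_Integration.integrable_restrict_Int pq .
  qed
  then obtain N where N: "negligible N"
    and lim: "\<And>x e. x \<notin> N \<Longrightarrow> 0 < e \<Longrightarrow>
      \<exists>d>0. \<forall>h. 0 < h \<and> h < d \<longrightarrow> norm (integral (cbox x (x + h *\<^sub>R One)) g /\<^sub>R h ^ DIM('a) - g x) < e"
    using integrable_ccontinuous_explicit[of g] by blast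
  have "f x = 0" if x: "x \<in> box a b" "x \<notin> N" for x
  proof (rule ccontr)
    assume "f x \<noteq> 0"
    then obtain d where d: "d > 0"
      and less: "\<And>h. 0 < h \<Longrightarrow> h < d \<Longrightarrow>
        norm (integral (cbox x (x + h *\<^sub>R One)) g /\<^sub>R h ^ DIM('a) - g x) < \<bar>f x\<bar>"
      using lim[OF x(2), of "\<bar>f x\<bar>"] by auto
    have "eventually (\<lambda>h. x + h *\<^sub>R One \<in> box a b) (at_right 0)"
    proof (rule topological_tendstoD)
      show "((\<lambda>h. x + h *\<^sub>R One) \<longlongrightarrow> x) (at_right 0)"
        by (auto intro!: tendsto_eq_intros)
    qed (use x in auto)
    moreover have "eventually (\<lambda>h. 0 < h \<and> h < d) (at_right 0)"
      using d by (auto simp: eventually_at_right_field)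
    ultimately have "eventually (\<lambda>h. 0 < h \<and> h < d \<and> x + h *\<^sub>R One \<in> box a b) (at_right 0)"
      by eventually_elim auto
    then obtain h where h: "0 < h" "h < d" "x + h *\<^sub>R One \<in> box a b"
      using eventually_happens'[OF trivial_limit_at_right_real] by blast
    have sub: "cbox x (x + h *\<^sub>R One) \<subseteq> cbox a b"
      using h x box_subset_cbox by (intro subset_box_imp(1)) (auto simp: mem_box less_imp_le)
    have "integral (cbox x (x + h *\<^sub>R One)) g = integral (cbox x (x + h *\<^sub>R One)) f"
      using sub by (intro integral_cong) (auto simp: g_def)
    then have "norm (0 /\<^sub>R h ^ DIM('a) - g x) < \<bar>f x\<bar>"
      using less[OF h(1,2)] zero[OF sub] by simp
    moreover have "x \<in> cbox a b"
      using x box_subset_cbox by blast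
    ultimately show False
      by (simp add: g_def)
  qed
  then have "{x \<in> cbox a b. f x \<noteq> 0} \<subseteq> N \<union> (cbox a b - box a b)"
    by blast
  then show ?thesis
    using N negligible_frontier_interval negligible_Un negligible_subset by blast
qed

lemma negligible_if_negligible_on_cboxes:
  fixes U :: "'a::euclidean_space set"
  assumes "open U" and neg: "\<And>a b. cbox a b \<subseteq> U \<Longrightarrow> negligible {x \<in> cbox a b. P x}"
  shows "negligible {x \<in> U. P x}"
proof -
  obtain \<D> where \<D>: "countable \<D>" "\<D> \<subseteq> Pow U" "\<And>K. K \<in> \<D> \<Longrightarrow> \<exists>a b. K = cbox a b" "\<Union>\<D> = U"
    using open_countable_Union_open_cbox[OF assms(1)] by blast
  have "negligible (\<Union>((\<lambda>K. {x \<in> K. P x}) ` \<D>))"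
  proof (intro negligible_countable_Union countable_image \<D>(1))
    fix T assume "T \<in> (\<lambda>K. {x \<in> K. P x}) ` \<D>"
    then obtain K where K: "K \<in> \<D>" "T = {x \<in> K. P x}" by blast
    with \<D>(2) \<D>(3)[OF K(1)] neg show "negligible T" by blast
  qed
  moreover have "\<Union>((\<lambda>K. {x \<in> K. P x}) ` \<D>) = {x \<in> U. P x}"
    using \<D>(4) by auto
  ultimately show ?thesis by simp
qed

lemma locally_integrable_on_diff:
  assumes "locally_integrable_on U f" "locally_integrable_on U g"
  shows "locally_integrable_on U (\<lambda>x. f x - g x)"
  using assms by (simp add: locally_integrable_on_def)

text \<open>
  Vanishing against all test functions forces all integrals over boxes inside the open set to
  vanish, hence the function vanishes almost everywhere on each such box; countably many of them
  cover the open set.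
\<close>

lemma fundamental_lemma_calculus_of_variations:
  fixes f :: "'a::euclidean_space \<Rightarrow> real"
  assumes f: "locally_integrable_on (interior \<Omega>) f" and \<Omega>: "\<Omega> \<in> sets lebesgue"
    and test: "\<And>\<phi>. test_function (interior \<Omega>) \<phi> \<Longrightarrow> (\<integral>x. f x * \<phi> x \<partial>lebesgue_on \<Omega>) = 0"
  shows "negligible {x \<in> interior \<Omega>. f x \<noteq> 0}"
proof (rule negligible_if_negligible_on_cboxes)
  fix a b assume ab: "cbox a b \<subseteq> interior \<Omega>"
  show "negligible {x \<in> cbox a b. f x \<noteq> 0}"
  proof (rule negligible_nonzero_if_cbox_integrals_0)
    have "integrable (lebesgue_on (cbox a b)) f"
      using f ab by (simp add: locally_integrable_on_def)
    then show "f integrable_on cbox a b"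
      by (rule integrable_on_lebesgue_on) simp
    show "integral (cbox c d) f = 0" if "cbox c d \<subseteq> cbox a b" for c d
      using integral_box_eq_0_if_test_integrals_0[OF f \<Omega> test] that ab by blast
  qed
qed simp

section \<open>Uniqueness of weak derivatives\<close>

lemma integrable_lebesgue_on_subset:
  fixes f :: "'a::euclidean_space \<Rightarrow> real"
  assumes "integrable (lebesgue_on T) f" "S \<subseteq> T" "S \<in> sets lebesgue" "T \<in> sets lebesgue"
  shows "integrable (lebesgue_on S) f"
proof -
  have "integrable lebesgue (\<lambda>x. if x \<in> T then f x else 0)"
    using assms(1,4) by (simp add: Lebesgue_Measure.integrable_restrict_UNIV)
  then have "integrable lebesgue (\<lambda>x. indicator S x *\<^sub>R (if x \<in> T then f x else 0))"
    by (rule integrable_mult_indicator[OF assms(3)])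
  moreover have "indicator S x *\<^sub>R (if x \<in> T then f x else 0) = (if x \<in> S then f x else 0)" for x
    using assms(2) by (cases "x \<in> S") auto
  ultimately have "integrable lebesgue (\<lambda>x. if x \<in> S then f x else 0)"
    by (simp only:)
  then show ?thesis
    using Lebesgue_Measure.integrable_restrict_UNIV[OF assms(3)] by blast
qed

text \<open>
  A locally integrable function need not be integrable near the boundary, but the product with a
  test function lives on a compact subset of the open set, where the test function is bounded.
\<close>

lemma integrable_mult_test_function:
  fixes f \<phi> :: "'a::euclidean_space \<Rightarrow> real"
  assumes f: "locally_integrable_on U f" and \<phi>: "test_function U \<phi>" and S: "S \<in> sets lebesgue"
  shows "integrable (lebesgue_on S) (\<lambda>x. f x * \<phi> x)"
proof -
  define K where "K = closure {x. \<phi> x \<noteq> 0}"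
  have K: "compact K" "K \<subseteq> U" and "C_k 0 \<phi>"
    using \<phi> unfolding test_function_def K_def by blast+
  then have cont: "continuous_on K \<phi>"
    using continuous_on_subset[of UNIV \<phi> K] by simp
  have Ks: "K \<in> sets lebesgue"
    using compact_imp_closed[OF K(1)] by simp
  have f: "integrable (lebesgue_on K) f"
    using f K by (simp add: locally_integrable_on_def)
  obtain M where M: "\<And>x. x \<in> K \<Longrightarrow> \<bar>\<phi> x\<bar> \<le> M"
    using compact_imp_bounded[OF compact_continuous_image[OF cont K(1)]]
    by (auto simp: bounded_iff)
  have "integrable (lebesgue_on K) (\<lambda>x. f x * \<phi> x)"
  proof (rule Bochner_Integration.integrable_bound)
    show "integrable (lebesgue_on K) (\<lambda>x. M * f x)"
      using f by simp
    show "(\<lambda>x. f x * \<phi> x) \<in> borel_measurable (lebesgue_on K)"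
      using f continuous_imp_measurable_on_sets_lebesgue[OF cont Ks]
      by (intro borel_measurable_times) auto
    have "\<bar>f x * \<phi> x\<bar> \<le> \<bar>M * f x\<bar>" if "x \<in> K" for x
    proof -
      have "\<bar>\<phi> x\<bar> * \<bar>f x\<bar> \<le> \<bar>M\<bar> * \<bar>f x\<bar>"
        using M[OF that] by (intro mult_right_mono) auto
      then show ?thesis by (simp add: abs_mult mult.commute)
    qed
    then show "AE x in lebesgue_on K. norm (f x * \<phi> x) \<le> norm (M * f x)"
      by (intro AE_I2) simp
  qed
  then have "integrable lebesgue (\<lambda>x. if x \<in> K then f x * \<phi> x else 0)"
    using Ks by (simp add: Lebesgue_Measure.integrable_restrict_UNIV)
  also have "(\<lambda>x. if x \<in> K then f x * \<phi> x else 0) = (\<lambda>x. f x * \<phi> x)"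
    by (rule ext) (use closure_subset[of "{x. \<phi> x \<noteq> 0}"] in \<open>auto simp: K_def\<close>)
  finally have "integrable (lebesgue_on UNIV) (\<lambda>x. f x * \<phi> x)"
    by (simp add: lebesgue_on_UNIV_eq)
  then show ?thesis
    by (rule integrable_lebesgue_on_subset) (use S in auto)
qed

text \<open>
  This makes the energy of a concrete function computable: whatever representative the choice
  operator selects, it agrees almost everywhere with any weak derivative that is at hand.
\<close>

lemma weak_partial_unique:
  assumes \<Omega>: "\<Omega> \<in> sets lebesgue"
    and g: "has_weak_partial \<Omega> i u g" and h: "has_weak_partial \<Omega> i u h"
  shows "negligible {x \<in> interior \<Omega>. g x \<noteq> h x}"
proof -
  have "negligible {x \<in> interior \<Omega>. g x - h x \<noteq> 0}"
  proof (rule fundamental_lemma_calculus_of_variations[OF _ \<Omega>])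
    show "locally_integrable_on (interior \<Omega>) (\<lambda>x. g x - h x)"
      using g h by (auto simp: has_weak_partial_def intro: locally_integrable_on_diff)
    fix \<phi> assume \<phi>: "test_function (interior \<Omega>) \<phi>"
    have "(\<integral>x. g x * \<phi> x \<partial>lebesgue_on \<Omega>) = (\<integral>x. h x * \<phi> x \<partial>lebesgue_on \<Omega>)"
      using g h \<phi> by (force simp: has_weak_partial_def)
    moreover have "integrable (lebesgue_on \<Omega>) (\<lambda>x. g x * \<phi> x)" "integrable (lebesgue_on \<Omega>) (\<lambda>x. h x * \<phi> x)"
      using g h by (auto simp: has_weak_partial_def intro: integrable_mult_test_function[OF _ \<phi> \<Omega>])
    ultimately show "(\<integral>x. (g x - h x) * \<phi> x \<partial>lebesgue_on \<Omega>) = 0"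
      by (simp add: left_diff_distrib)
  qed
  then show ?thesis by simp
qed

section \<open>Classical derivatives on the rectangle as weak derivatives\<close>

lemma rect_eq_cbox: "rect L = cbox (0, 0) (L, 1)"
  by (auto simp: rect_def)

lemma rect_sets [simp]: "rect L \<in> sets lebesgue"
  by (simp add: rect_eq_cbox)

lemma interior_rect: "interior (rect L) = {0<..<L} \<times> {0<..<1}"
  by (simp add: rect_def interior_Times)

lemma negligible_rect_if_interior:
  assumes "negligible {z \<in> interior (rect L). P z}"
  shows "negligible {z \<in> rect L. P z}"
proof (rule negligible_subset)
  show "negligible ({z \<in> interior (rect L). P z} \<union> (cbox (0, 0) (L, 1) - box (0, 0) (L, 1)))"
    using assms negligible_frontier_interval by (rule negligible_Un)
qed (auto simp: rect_eq_cbox interior_cbox)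

lemma integrable_rect_if_continuous:
  fixes f :: "real \<times> real \<Rightarrow> real"
  assumes "continuous_on UNIV f"
  shows "integrable (lebesgue_on (rect L)) f"
  unfolding rect_eq_cbox
  by (rule continuous_imp_integrable) (rule continuous_on_subset[OF assms subset_UNIV])

lemma locally_integrable_on_if_continuous:
  fixes f :: "'a::euclidean_space \<Rightarrow> real"
  assumes "continuous_on UNIV f"
  shows "locally_integrable_on U f"
proof -
  have "integrable (lebesgue_on K) f" if "compact K" for K
  proof -
    obtain a b where ab: "K \<subseteq> cbox a b"
      using bounded_subset_cbox_symmetric compact_imp_bounded[OF \<open>compact K\<close>] by metis
    have "integrable (lebesgue_on (cbox a b)) f"
      by (rule continuous_imp_integrable) (rule continuous_on_subset[OF assms subset_UNIV])
    then show ?thesis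
      by (rule integrable_lebesgue_on_subset) (use ab compact_imp_closed[OF that] in simp_all)
  qed
  then show ?thesis by (simp add: locally_integrable_on_def)
qed

lemma L2_on_rect_if_continuous:
  assumes "continuous_on UNIV f"
  shows "L2_on (rect L) f"
  unfolding L2_on_def
  using integrable_rect_if_continuous[OF assms]
    integrable_rect_if_continuous[OF continuous_on_power[OF assms]] by auto

lemma test_function_partials:
  fixes \<phi> :: "real \<times> real \<Rightarrow> real"
  assumes "test_function U \<phi>"
  shows "continuous_on UNIV \<phi>"
    and "continuous_on UNIV (partial (1, 0) \<phi>)" "continuous_on UNIV (partial (0, 1) \<phi>)"
    and "((\<lambda>x. \<phi> (x, y)) has_real_derivative partial (1, 0) \<phi> (x, y)) (at x)"
    and "((\<lambda>y. \<phi> (x, y)) has_real_derivative partial (0, 1) \<phi> (x, y)) (at y)"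
proof -
  have C: "C_k 0 \<phi>" "C_k (Suc 0) \<phi>"
    using assms unfolding test_function_def by blast+
  then show "continuous_on UNIV \<phi>" "continuous_on UNIV (partial (1, 0) \<phi>)"
    "continuous_on UNIV (partial (0, 1) \<phi>)"
    by (auto simp: Basis_prod_def)
  have D: "(\<phi> has_derivative frechet_derivative \<phi> (at z)) (at z)" for z
    using C(2) by (cases z) (simp add: frechet_derivative_works)
  have lin: "linear (frechet_derivative \<phi> (at z))" for z
    using D has_derivative_linear by blast
  have Dx: "((\<lambda>x. \<phi> (x, y)) has_derivative (\<lambda>h. frechet_derivative \<phi> (at (x, y)) (h, 0))) (at x)"
    by (rule has_derivative_compose[OF _ D]) (auto intro!: derivative_eq_intros)
  have "(\<lambda>h. frechet_derivative \<phi> (at (x, y)) (h, 0)) = (\<lambda>h. partial (1, 0) \<phi> (x, y) * h)"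
  proof
    fix h
    show "frechet_derivative \<phi> (at (x, y)) (h, 0) = partial (1, 0) \<phi> (x, y) * h"
      using linear_scale[OF lin, of "(x, y)" h "(1, 0)"] by simp
  qed
  then show "((\<lambda>x. \<phi> (x, y)) has_real_derivative partial (1, 0) \<phi> (x, y)) (at x)"
    unfolding has_field_derivative_def by (rule has_derivative_eq_rhs[OF Dx])
  have Dy: "((\<lambda>y. \<phi> (x, y)) has_derivative (\<lambda>h. frechet_derivative \<phi> (at (x, y)) (0, h))) (at y)"
    by (rule has_derivative_compose[OF _ D]) (auto intro!: derivative_eq_intros)
  have "(\<lambda>h. frechet_derivative \<phi> (at (x, y)) (0, h)) = (\<lambda>h. partial (0, 1) \<phi> (x, y) * h)"
  proof
    fix h
    show "frechet_derivative \<phi> (at (x, y)) (0, h) = partial (0, 1) \<phi> (x, y) * h"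
      using linear_scale[OF lin, of "(x, y)" h "(0, 1)"] by simp
  qed
  then show "((\<lambda>y. \<phi> (x, y)) has_real_derivative partial (0, 1) \<phi> (x, y)) (at y)"
    unfolding has_field_derivative_def by (rule has_derivative_eq_rhs[OF Dy])
qed

lemma test_function_zero_outside:
  assumes "test_function U \<phi>" "z \<notin> U"
  shows "\<phi> z = 0"
  using assms closure_subset[of "{x. \<phi> x \<noteq> 0}"] unfolding test_function_def by blast

text \<open>
  Fubini for continuous integrands, with the inner integration along the direction of the
  derivative, reduces this to the fundamental theorem of calculus on each segment. The lemma after
  it treats the other direction. Applied to the product of a function with a test function, the two
  lemmas are integration by parts without boundary terms.
\<close>

lemma integral_rect_dx_eq_0:
  assumes "L > 0" "continuous_on UNIV w'"
    and D: "\<And>x y. ((\<lambda>x. w (x, y)) has_real_derivative w' (x, y)) (at x)"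
    and "\<And>y. w (0, y) = 0" "\<And>y. w (L, y) = (0::real)"
  shows "integral\<^sup>L (lebesgue_on (rect L)) w' = 0"
proof -
  have cont: "continuous_on (cbox (0, 0) (L, 1)) w'"
    by (rule continuous_on_subset[OF assms(2) subset_UNIV])
  have "integral\<^sup>L (lebesgue_on (rect L)) w' = integral (rect L) w'"
    by (intro lebesgue_integral_eq_integral integrable_rect_if_continuous assms) simp
  also have "\<dots> = integral (cbox 0 L) (\<lambda>x. integral (cbox 0 1) (\<lambda>y. w' (x, y)))"
    unfolding rect_eq_cbox by (rule integral_prod_continuous[OF cont])
  also have "\<dots> = integral (cbox 0 1) (\<lambda>y. integral (cbox 0 L) (\<lambda>x. w' (x, y)))"
    using integral_swap_continuous[of 0 0 L 1 "\<lambda>x y. w' (x, y)"] cont by simp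
  also have "\<dots> = integral (cbox (0::real) 1) (\<lambda>y. 0)"
  proof (rule Henstock_Kurzweil_Integration.integral_cong)
    fix y :: real
    have "((\<lambda>x. w' (x, y)) has_integral w (L, y) - w (0, y)) {0..L}"
      using assms(1) D
      by (intro fundamental_theorem_of_calculus)
        (auto simp flip: has_real_derivative_iff_has_vector_derivative intro: has_field_derivative_at_within)
    then show "integral (cbox 0 L) (\<lambda>x. w' (x, y)) = 0"
      using assms by (simp add: integral_unique)
  qed
  finally show ?thesis by simp
qed

lemma integral_rect_dy_eq_0:
  assumes "continuous_on UNIV w'"
    and D: "\<And>x y. ((\<lambda>y. w (x, y)) has_real_derivative w' (x, y)) (at y)"
    and "\<And>x. w (x, 0) = 0" "\<And>x. w (x, 1) = (0::real)"
  shows "integral\<^sup>L (lebesgue_on (rect L)) w' = 0"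
proof -
  have cont: "continuous_on (cbox (0, 0) (L, 1)) w'"
    by (rule continuous_on_subset[OF assms(1) subset_UNIV])
  have "integral\<^sup>L (lebesgue_on (rect L)) w' = integral (rect L) w'"
    by (intro lebesgue_integral_eq_integral integrable_rect_if_continuous assms) simp
  also have "\<dots> = integral (cbox 0 L) (\<lambda>x. integral (cbox 0 1) (\<lambda>y. w' (x, y)))"
    unfolding rect_eq_cbox by (rule integral_prod_continuous[OF cont])
  also have "\<dots> = integral (cbox 0 L) (\<lambda>x. 0)"
  proof (rule Henstock_Kurzweil_Integration.integral_cong)
    fix x :: real
    have "((\<lambda>y. w' (x, y)) has_integral w (x, 1) - w (x, 0)) {0..1}"
      using D
      by (intro fundamental_theorem_of_calculus)
        (auto simp flip: has_real_derivative_iff_has_vector_derivative intro: has_field_derivative_at_within)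
    then show "integral (cbox 0 1) (\<lambda>y. w' (x, y)) = 0"
      using assms by (simp add: integral_unique)
  qed
  finally show ?thesis by simp
qed

lemma has_weak_partial_x_if_classical:
  assumes "L > 0" and u: "continuous_on UNIV u" and u': "continuous_on UNIV u'"
    and D: "\<And>x y. ((\<lambda>x. u (x, y)) has_real_derivative u' (x, y)) (at x)"
  shows "has_weak_partial (rect L) (1, 0) u u'"
  unfolding has_weak_partial_def
proof (intro conjI allI impI locally_integrable_on_if_continuous u u')
  fix \<phi> assume \<phi>: "test_function (interior (rect L)) \<phi>"
  note p = test_function_partials[OF \<phi>]
  have zero: "\<phi> (0, y) = 0" "\<phi> (L, y) = 0" for y
    by (auto intro!: test_function_zero_outside[OF \<phi>] simp: interior_rect)
  have "(\<integral>z. u' z * \<phi> z + u z * partial (1, 0) \<phi> z \<partial>lebesgue_on (rect L)) = 0"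
  proof (rule integral_rect_dx_eq_0[OF assms(1), where w="\<lambda>z. u z * \<phi> z"])
    show "((\<lambda>x. u (x, y) * \<phi> (x, y)) has_real_derivative
        u' (x, y) * \<phi> (x, y) + u (x, y) * partial (1, 0) \<phi> (x, y)) (at x)" for x y
      by (rule DERIV_cong[OF DERIV_mult[OF D p(4)]]) (simp add: mult.commute)
    show "continuous_on UNIV (\<lambda>z. u' z * \<phi> z + u z * partial (1, 0) \<phi> z)"
      by (intro continuous_on_add continuous_on_mult u u' p)
  qed (use zero in simp_all)
  moreover have "integrable (lebesgue_on (rect L)) (\<lambda>z. u' z * \<phi> z)"
    "integrable (lebesgue_on (rect L)) (\<lambda>z. u z * partial (1, 0) \<phi> z)"
    by (intro integrable_rect_if_continuous continuous_on_mult u u' p)+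
  ultimately show "(\<integral>z. u z * partial (1, 0) \<phi> z \<partial>lebesgue_on (rect L))
      = - (\<integral>z. u' z * \<phi> z \<partial>lebesgue_on (rect L))"
    by simp
qed

lemma has_weak_partial_y_if_classical:
  assumes u: "continuous_on UNIV u" and u': "continuous_on UNIV u'"
    and D: "\<And>x y. ((\<lambda>y. u (x, y)) has_real_derivative u' (x, y)) (at y)"
  shows "has_weak_partial (rect L) (0, 1) u u'"
  unfolding has_weak_partial_def
proof (intro conjI allI impI locally_integrable_on_if_continuous u u')
  fix \<phi> assume \<phi>: "test_function (interior (rect L)) \<phi>"
  note p = test_function_partials[OF \<phi>]
  have zero: "\<phi> (x, 0) = 0" "\<phi> (x, 1) = 0" for x
    by (auto intro!: test_function_zero_outside[OF \<phi>] simp: interior_rect)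
  have "(\<integral>z. u' z * \<phi> z + u z * partial (0, 1) \<phi> z \<partial>lebesgue_on (rect L)) = 0"
  proof (rule integral_rect_dy_eq_0[where w="\<lambda>z. u z * \<phi> z"])
    show "((\<lambda>y. u (x, y) * \<phi> (x, y)) has_real_derivative
        u' (x, y) * \<phi> (x, y) + u (x, y) * partial (0, 1) \<phi> (x, y)) (at y)" for x y
      by (rule DERIV_cong[OF DERIV_mult[OF D p(5)]]) (simp add: mult.commute)
    show "continuous_on UNIV (\<lambda>z. u' z * \<phi> z + u z * partial (0, 1) \<phi> z)"
      by (intro continuous_on_add continuous_on_mult u u' p)
  qed (use zero in simp_all)
  moreover have "integrable (lebesgue_on (rect L)) (\<lambda>z. u' z * \<phi> z)"
    "integrable (lebesgue_on (rect L)) (\<lambda>z. u z * partial (0, 1) \<phi> z)"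
    by (intro integrable_rect_if_continuous continuous_on_mult u u' p)+
  ultimately show "(\<integral>z. u z * partial (0, 1) \<phi> z \<partial>lebesgue_on (rect L))
      = - (\<integral>z. u' z * \<phi> z \<partial>lebesgue_on (rect L))"
    by simp
qed

lemma weak_partial_rect_eq_AE:
  assumes "has_weak_partial (rect L) i u g"
  shows "has_weak_partial (rect L) i u (weak_partial (rect L) i u)"
    and "negligible {z \<in> rect L. weak_partial (rect L) i u z \<noteq> g z}"
proof -
  show *: "has_weak_partial (rect L) i u (weak_partial (rect L) i u)"
    unfolding weak_partial_def by (rule someI[of "has_weak_partial (rect L) i u" g]) (rule assms)
  show "negligible {z \<in> rect L. weak_partial (rect L) i u z \<noteq> g z}"
    by (intro negligible_rect_if_interior weak_partial_unique[OF _ * assms]) simp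
qed

text \<open>
  The energy contains the weak \<open>y\<close>-derivative of the chosen representative of \<open>u\<^sub>y\<close>, not of the
  classical \<open>u\<^sub>y\<close>; this lemma bridges the difference.
\<close>

lemma has_weak_partial_y_spike:
  assumes g: "has_weak_partial (rect L) (0, 1) u g" and u: "continuous_on UNIV u"
    and v: "locally_integrable_on (interior (rect L)) v" "negligible {z \<in> rect L. v z \<noteq> u z}"
  shows "has_weak_partial (rect L) (0, 1) v g"
  unfolding has_weak_partial_def
proof (intro conjI allI impI v(1))
  show "locally_integrable_on (interior (rect L)) g"
    using g by (simp add: has_weak_partial_def)
  fix \<phi> assume \<phi>: "test_function (interior (rect L)) \<phi>"
  have "(\<integral>z. v z * partial (0, 1) \<phi> z \<partial>lebesgue_on (rect L))
      = (\<integral>z. u z * partial (0, 1) \<phi> z \<partial>lebesgue_on (rect L))"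
  proof (rule integral_lebesgue_on_spike)
    show "integrable (lebesgue_on (rect L)) (\<lambda>z. u z * partial (0, 1) \<phi> z)"
      by (intro integrable_rect_if_continuous continuous_on_mult u test_function_partials[OF \<phi>])
    show "negligible {z \<in> rect L. v z * partial (0, 1) \<phi> z \<noteq> u z * partial (0, 1) \<phi> z}"
      by (rule negligible_subset[OF v(2)]) auto
  qed simp
  also have "\<dots> = - (\<integral>z. g z * \<phi> z \<partial>lebesgue_on (rect L))"
    using g \<phi> by (simp add: has_weak_partial_def)
  finally show "(\<integral>z. v z * partial (0, 1) \<phi> z \<partial>lebesgue_on (rect L))
      = - (\<integral>z. g z * \<phi> z \<partial>lebesgue_on (rect L))" .
qed

section \<open>Admissibility and energy of functions with classical derivatives\<close>

text \<open>
  Only the derivatives that occur in the energy are recorded; they are required to be continuous on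
  the whole plane, so that restrictions to boxes need no further argument.
\<close>

definition classical_partials ::
  "(real \<times> real \<Rightarrow> real) \<Rightarrow> (real \<times> real \<Rightarrow> real) \<Rightarrow> (real \<times> real \<Rightarrow> real) \<Rightarrow> (real \<times> real \<Rightarrow> real) \<Rightarrow> bool" where
  "classical_partials u ux uy uyy \<longleftrightarrow>
     continuous_on UNIV u \<and> continuous_on UNIV ux \<and> continuous_on UNIV uy \<and> continuous_on UNIV uyy \<and>
     (\<forall>x y. ((\<lambda>x. u (x, y)) has_real_derivative ux (x, y)) (at x) \<and>
            ((\<lambda>y. u (x, y)) has_real_derivative uy (x, y)) (at y) \<and>
            ((\<lambda>y. uy (x, y)) has_real_derivative uyy (x, y)) (at y))"

lemma classical_partials_weak:
  assumes "L > 0" "classical_partials u ux uy uyy"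
  shows "has_weak_partial (rect L) (1, 0) u ux" "has_weak_partial (rect L) (0, 1) u uy"
    and "has_weak_partial (rect L) (0, 1) (D_y L u) uyy"
    and "negligible {z \<in> rect L. D_x L u z \<noteq> ux z}" "negligible {z \<in> rect L. D_y L u z \<noteq> uy z}"
    and "negligible {z \<in> rect L. D_y L (D_y L u) z \<noteq> uyy z}"
proof -
  note c = assms(2)[unfolded classical_partials_def]
  show x: "has_weak_partial (rect L) (1, 0) u ux"
    using c by (intro has_weak_partial_x_if_classical assms(1)) auto
  show y: "has_weak_partial (rect L) (0, 1) u uy"
    using c by (intro has_weak_partial_y_if_classical) auto
  show "negligible {z \<in> rect L. D_x L u z \<noteq> ux z}"
    using weak_partial_rect_eq_AE(2)[OF x] .
  show ny: "negligible {z \<in> rect L. D_y L u z \<noteq> uy z}"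
    using weak_partial_rect_eq_AE(2)[OF y] .
  have cuy: "continuous_on UNIV uy" "has_weak_partial (rect L) (0, 1) uy uyy"
    using c by (auto intro: has_weak_partial_y_if_classical)
  have "locally_integrable_on (interior (rect L)) (D_y L u)"
    using weak_partial_rect_eq_AE(1)[OF y] unfolding has_weak_partial_def by blast
  then show yy: "has_weak_partial (rect L) (0, 1) (D_y L u) uyy"
    by (rule has_weak_partial_y_spike[OF cuy(2,1) _ ny])
  show "negligible {z \<in> rect L. D_y L (D_y L u) z \<noteq> uyy z}"
    using weak_partial_rect_eq_AE(2)[OF yy] .
qed

text \<open>
  The constant sequence \<open>u\<close> is an approximating sequence of the kind that defines traces.
\<close>

lemma has_trace_zero_if_continuous:
  assumes "u \<in> W12 \<Omega>" "continuous_on UNIV u" "\<And>t. t \<in> I \<Longrightarrow> u (\<gamma> t) = 0"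
  shows "has_trace \<Omega> \<gamma> I u (\<lambda>t. 0)"
proof -
  have "(\<integral>t. (u (\<gamma> t) - 0)\<^sup>2 \<partial>lebesgue_on I) = (\<integral>t. 0 \<partial>lebesgue_on I)"
    using assms(3) by (intro Bochner_Integration.integral_cong) auto
  then show ?thesis
    unfolding has_trace_def
    using assms continuous_on_subset[OF assms(2) subset_UNIV]
    by (auto simp: L2_on_def W12_sqdist_def intro!: exI[of _ "\<lambda>n. u"])
qed

lemma Adm1_if_classical:
  assumes "L > 0" "classical_partials u ux uy uyy"
    and "\<And>y. u (0, y) = 0" "\<And>x. u (x, 0) = 0" "\<And>x. u (x, 1) = 0"
  shows "u \<in> Adm1 L"
proof -
  note c = assms(2)[unfolded classical_partials_def]
  note w = classical_partials_weak[OF assms(1,2)]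
  have L2: "L2_on (rect L) u" "L2_on (rect L) ux" "L2_on (rect L) uy" "L2_on (rect L) uyy"
    using c by (auto intro: L2_on_rect_if_continuous)
  have u: "u \<in> W12 (rect L)"
    using w(1,2) L2 by (auto simp: W12_def Basis_prod_def)
  note tr = has_trace_zero_if_continuous[OF u]
  show ?thesis
    unfolding Adm1_def W12_per_def
    using u w(3) L2(4) c tr[of "{0..L}" "\<lambda>x. (x, 0)"] tr[of "{0..L}" "\<lambda>x. (x, 1)"]
      tr[of "{0..1}" "\<lambda>y. (0, y)"] assms(3-5) by blast
qed

lemma lmeasurable_rect_sublevel:
  fixes f :: "real \<times> real \<Rightarrow> real"
  assumes "continuous_on UNIV f"
  shows "{z \<in> rect L. \<bar>f z\<bar> < c} \<in> lmeasurable" "{z \<in> rect L. c \<le> \<bar>f z\<bar>} \<in> lmeasurable"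
proof -
  have R: "rect L \<in> lmeasurable"
    by (simp add: rect_eq_cbox)
  have "open {z. \<bar>f z\<bar> < c}"
    by (rule open_Collect_less[OF continuous_on_rabs[OF assms] continuous_on_const])
  then have "rect L \<inter> {z. \<bar>f z\<bar> < c} \<in> lmeasurable"
    using R by (intro fmeasurable_Int_fmeasurable) auto
  then show 1: "{z \<in> rect L. \<bar>f z\<bar> < c} \<in> lmeasurable"
    by (simp add: Int_def)
  have "{z \<in> rect L. c \<le> \<bar>f z\<bar>} = rect L - {z \<in> rect L. \<bar>f z\<bar> < c}"
    by auto
  then show "{z \<in> rect L. c \<le> \<bar>f z\<bar>} \<in> lmeasurable"
    using R 1 by (simp add: fmeasurable.Diff)
qed

lemma classical_energy:
  assumes "L > 0" "classical_partials u ux uy uyy"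
  shows "measure lebesgue (B_set L u) = measure lebesgue {z \<in> rect L. 1 \<le> \<bar>uy z\<bar>}"
    and "E1 L \<epsilon> \<Delta> u = (\<integral>z. \<epsilon>\<^sup>2 * (uyy z)\<^sup>2 + (ux z)\<^sup>2 \<partial>lebesgue_on (rect L))
      + \<Delta> * measure lebesgue {z \<in> rect L. \<bar>uy z\<bar> < 1}"
proof -
  note c = assms(2)[unfolded classical_partials_def]
  note w = classical_partials_weak[OF assms(1,2)]
  show "measure lebesgue (B_set L u) = measure lebesgue {z \<in> rect L. 1 \<le> \<bar>uy z\<bar>}"
    by (rule measure_negligible_symdiff)
      (use c in \<open>auto simp: B_set_def intro!: lmeasurable_rect_sublevel negligible_subset[OF w(5)]\<close>)
  have "measure lebesgue (A_set L u) = measure lebesgue {z \<in> rect L. \<bar>uy z\<bar> < 1}"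
    by (rule measure_negligible_symdiff)
      (use c in \<open>auto simp: B_set_def A_set_def intro!: lmeasurable_rect_sublevel negligible_subset[OF w(5)]\<close>)
  moreover have "(\<integral>z. \<epsilon>\<^sup>2 * (D_y L (D_y L u) z)\<^sup>2 + (D_x L u z)\<^sup>2 \<partial>lebesgue_on (rect L))
      = (\<integral>z. \<epsilon>\<^sup>2 * (uyy z)\<^sup>2 + (ux z)\<^sup>2 \<partial>lebesgue_on (rect L))"
  proof (rule integral_lebesgue_on_spike)
    show "integrable (lebesgue_on (rect L)) (\<lambda>z. \<epsilon>\<^sup>2 * (uyy z)\<^sup>2 + (ux z)\<^sup>2)"
      using c by (intro integrable_rect_if_continuous continuous_intros) auto
    show "negligible {z \<in> rect L. \<epsilon>\<^sup>2 * (D_y L (D_y L u) z)\<^sup>2 + (D_x L u z)\<^sup>2 \<noteq> \<epsilon>\<^sup>2 * (uyy z)\<^sup>2 + (ux z)\<^sup>2}"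
      by (rule negligible_subset[OF negligible_Un[OF w(4,6)]]) auto
  qed simp
  ultimately show "E1 L \<epsilon> \<Delta> u = (\<integral>z. \<epsilon>\<^sup>2 * (uyy z)\<^sup>2 + (ux z)\<^sup>2 \<partial>lebesgue_on (rect L))
      + \<Delta> * measure lebesgue {z \<in> rect L. \<bar>uy z\<bar> < 1}"
    by (simp add: E1_def)
qed

lemma measure_rect:
  assumes "L > 0"
  shows "measure lebesgue (rect L) = L"
  using assms by (simp add: rect_eq_cbox content_Pair)

lemma E1_zero:
  assumes "L > 0"
  shows "E1 L \<epsilon> \<Delta> (\<lambda>z. 0) = \<Delta> * L"
proof -
  have "classical_partials (\<lambda>z. 0) (\<lambda>z. 0) (\<lambda>z. 0) (\<lambda>z. 0)"
    by (simp add: classical_partials_def)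
  from classical_energy(2)[OF assms this] show ?thesis
    using assms by (simp add: measure_rect)
qed

section \<open>Concentrated profiles and the vanishing energy barrier\<close>

lemma flat_algebra_real_derivative:
  fixes f :: "real \<Rightarrow> real"
  assumes "f \<in> flat_algebra"
  obtains f' where "f' \<in> flat_algebra" "\<And>t. (f has_real_derivative f' t) (at t)"
proof -
  obtain D where D: "\<And>t. (f has_derivative D t) (at t)" "\<And>v. (\<lambda>t. D t v) \<in> flat_algebra"
    using flat_algebra_derivative[OF assms] by blast
  have "D t h = D t 1 * h" for t h
    using linear_scale[OF has_derivative_linear[OF D(1)[of t]], of h 1] by (simp add: mult.commute)
  then have "D t = (*) (D t 1)" for t
    by blast
  then have "(f has_real_derivative D t 1) (at t)" for t
    unfolding has_field_derivative_def using D(1)[of t] by metis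
  then show thesis
    using that D(2) by blast
qed

lemma deriv_zero_outside:
  fixes f f' :: "real \<Rightarrow> real"
  assumes "\<And>t. (f has_real_derivative f' t) (at t)" "closed S"
    and "\<And>t. t \<notin> S \<Longrightarrow> f t = 0" "t \<notin> S"
  shows "f' t = 0"
proof -
  have "(f has_real_derivative 0) (at t)"
    by (rule has_field_derivative_transform_within_open[where f="\<lambda>_. 0" and S="- S"])
      (use assms in auto)
  then show ?thesis
    using assms(1) DERIV_unique by blast
qed

lemma bounded_if_compact_support:
  fixes f :: "real \<Rightarrow> real"
  assumes "continuous_on UNIV f" "\<And>t. t \<notin> {0..1} \<Longrightarrow> f t = 0"
  obtains M where "\<And>t. \<bar>f t\<bar> \<le> M"
proof -
  have "bounded (f ` {0..1})"
    by (intro compact_imp_bounded compact_continuous_image continuous_on_subset[OF assms(1)]) auto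
  then obtain M where "M > 0" "\<And>t. t \<in> {0..1} \<Longrightarrow> \<bar>f t\<bar> \<le> M"
    by (auto simp: bounded_pos)
  then have "\<bar>f t\<bar> \<le> M" for t
    using assms(2)[of t] by (cases "t \<in> {0..1}") auto
  then show thesis using that by blast
qed

text \<open>
  The one-dimensional profile of the construction below. Its derivative is nonzero somewhere by the
  mean value theorem, since the bump vanishes at \<open>0\<close> but not at \<open>1/2\<close>; this is what makes it
  possible to reach slope \<open>1\<close>.
\<close>

lemma interval_bump:
  obtains P P' P'' :: "real \<Rightarrow> real" and M s t :: real
  where "\<And>t. (P has_real_derivative P' t) (at t)" "\<And>t. (P' has_real_derivative P'' t) (at t)"
    and "continuous_on UNIV P''"
    and "\<And>t. t \<notin> {0..1} \<Longrightarrow> P t = 0 \<and> P' t = 0 \<and> P'' t = 0"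
    and "\<And>t. \<bar>P t\<bar> \<le> M \<and> \<bar>P' t\<bar> \<le> M \<and> \<bar>P'' t\<bar> \<le> M"
    and "P s \<noteq> 0" "P' t \<noteq> 0"
proof -
  define P :: "real \<Rightarrow> real" where "P = box_bump 0 1 1"
  have "P \<in> flat_algebra"
    by (simp add: P_def box_bump_flat_algebra)
  then obtain P' where P': "P' \<in> flat_algebra" "\<And>t. (P has_real_derivative P' t) (at t)"
    using flat_algebra_real_derivative by blast
  then obtain P'' where P'': "P'' \<in> flat_algebra" "\<And>t. (P' has_real_derivative P'' t) (at t)"
    using flat_algebra_real_derivative by blast
  have nz: "P t \<noteq> 0 \<longleftrightarrow> t \<in> {0<..<1}" for t
    using box_bump_nonzero_iff[of 1 0 1 t] by (simp add: P_def)
  have z: "P t = 0" if "t \<notin> {0..1}" for t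
    using nz[of t] that by auto
  have z': "P' t = 0" if "t \<notin> {0..1}" for t
    using deriv_zero_outside[OF P'(2) _ z] that by blast
  have z'': "P'' t = 0" if "t \<notin> {0..1}" for t
    using deriv_zero_outside[OF P''(2) _ z'] that by blast
  have cont: "continuous_on UNIV f" if "f \<in> flat_algebra" for f :: "real \<Rightarrow> real"
    using flat_algebra_C_k[OF that, of 0] by simp
  obtain M0 where M0: "\<And>t. \<bar>P t\<bar> \<le> M0"
    using bounded_if_compact_support[OF cont[OF \<open>P \<in> flat_algebra\<close>] z] by blast
  obtain M1 where M1: "\<And>t. \<bar>P' t\<bar> \<le> M1"
    using bounded_if_compact_support[OF cont[OF P'(1)] z'] by blast
  obtain M2 where M2: "\<And>t. \<bar>P'' t\<bar> \<le> M2"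
    using bounded_if_compact_support[OF cont[OF P''(1)] z''] by blast
  have M: "\<bar>P t\<bar> \<le> max M0 (max M1 M2) \<and> \<bar>P' t\<bar> \<le> max M0 (max M1 M2) \<and> \<bar>P'' t\<bar> \<le> max M0 (max M1 M2)" for t
    using M0[of t] M1[of t] M2[of t] by auto
  obtain t where "P (1/2) - P 0 = (1/2 - 0) * P' t"
    using MVT2[of 0 "1/2" P P'] P'(2) by auto
  then have "P' t \<noteq> 0"
    using nz[of "1/2"] nz[of 0] by auto
  then show thesis
    using that[of P P' P'' "max M0 (max M1 M2)" "1/2" t] P'(2) P''(2) cont[OF P''(1)] z z' z'' M nz[of "1/2"]
    by auto
qed

text \<open>
  The function \<open>u (x, y) = c h P (x / h\<^sup>2 - 1) P (y / h - 1)\<close> is supported in a box of size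
  \<open>h\<^sup>2 \<times> h\<close>. Its slope \<open>u\<^sub>y\<close> is of order \<open>1\<close>, and the constant \<open>c\<close> makes it equal to \<open>2\<close> at one
  point. Both \<open>u\<^sub>x\<close> (height \<open>h\<close> over width \<open>h\<^sup>2\<close>) and \<open>u\<^sub>y\<^sub>y\<close> (slope \<open>1\<close> over height \<open>h\<close>) are of
  order \<open>1 / h\<close>. The elastic energy is therefore of order \<open>h\<^sup>3 / h\<^sup>2 = h\<close>. The box of width
  \<open>h\<^sup>2\<close> is the choice that balances the two terms: with width \<open>l\<close> they are of order \<open>l / h\<close> and
  \<open>h\<^sup>3 / l\<close>. The shift by \<open>1\<close> keeps the support away from the boundary, so that all boundary
  conditions hold trivially.
\<close>

lemma concentrated_profiles:
  assumes "L > 0" "\<Delta> \<ge> 0"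
  obtains C where "\<And>h. 0 < h \<Longrightarrow> 2 * h\<^sup>2 < L \<Longrightarrow> 2 * h < 1 \<Longrightarrow>
    \<exists>u\<in>Adm1_plus L. measure lebesgue (B_set L u) \<le> h ^ 3 \<and>
      E1 L \<epsilon> \<Delta> u - E1 L \<epsilon> \<Delta> (\<lambda>z. 0) \<le> C * h"
proof -
  obtain P P' P'' :: "real \<Rightarrow> real" and M s t :: real
    where P: "\<And>t. (P has_real_derivative P' t) (at t)"
      and P': "\<And>t. (P' has_real_derivative P'' t) (at t)"
      and cont'': "continuous_on UNIV P''"
      and zero: "\<And>t. t \<notin> {0..1} \<Longrightarrow> P t = 0 \<and> P' t = 0 \<and> P'' t = 0"
      and M: "\<And>t. \<bar>P t\<bar> \<le> M \<and> \<bar>P' t\<bar> \<le> M \<and> \<bar>P'' t\<bar> \<le> M"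
      and st: "P s \<noteq> 0" "P' t \<noteq> 0"
    by (rule interval_bump) (rule that)
  define c where "c = 2 / (P s * P' t)"
  define K where "K = (\<epsilon>\<^sup>2 + 1) * (c * (M * M))\<^sup>2"
  have contP: "continuous_on UNIV P" "continuous_on UNIV P'"
    by (intro continuous_at_imp_continuous_on ballI DERIV_isCont[OF P] DERIV_isCont[OF P'])+
  show thesis
  proof (rule that)
    fix h :: real assume h: "0 < h" "2 * h\<^sup>2 < L" "2 * h < 1"
    define Q where "Q = cbox (h\<^sup>2, h) (2 * h\<^sup>2, 2 * h)"
    define X where "X = (\<lambda>z::real \<times> real. (1 / h\<^sup>2) * fst z - 1)"
    define Y where "Y = (\<lambda>z::real \<times> real. (1 / h) * snd z - 1)"
    define u where "u = (\<lambda>z. c * h * (P (X z) * P (Y z)))"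
    define ux where "ux = (\<lambda>z. c / h * (P' (X z) * P (Y z)))"
    define uy where "uy = (\<lambda>z. c * (P (X z) * P' (Y z)))"
    define uyy where "uyy = (\<lambda>z. c / h * (P (X z) * P'' (Y z)))"
    have contXY: "continuous_on UNIV X" "continuous_on UNIV Y"
      unfolding X_def Y_def using h(1) by (auto intro!: continuous_intros)
    have contc: "continuous_on UNIV (\<lambda>z. f (X z))" "continuous_on UNIV (\<lambda>z. f (Y z))"
      if "continuous_on UNIV f" for f :: "real \<Rightarrow> real"
      using continuous_on_compose2[OF that] contXY by auto
    have cont: "continuous_on UNIV u" "continuous_on UNIV ux" "continuous_on UNIV uy" "continuous_on UNIV uyy"
      unfolding u_def ux_def uy_def uyy_def
      by (intro continuous_on_mult continuous_on_const contc contP cont'')+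
    have DX: "((\<lambda>x. f (X (x, y))) has_real_derivative f' (X (x, y)) * (1 / h\<^sup>2)) (at x)"
      if "\<And>t. (f has_real_derivative f' t) (at t)" for f f' :: "real \<Rightarrow> real" and x y
      unfolding X_def fst_conv
      by (rule DERIV_chain2[OF that DERIV_cong[OF DERIV_diff[OF DERIV_cmult_Id DERIV_const]]]) simp
    have DY: "((\<lambda>y. f (Y (x, y))) has_real_derivative f' (Y (x, y)) * (1 / h)) (at y)"
      if "\<And>t. (f has_real_derivative f' t) (at t)" for f f' :: "real \<Rightarrow> real" and x y
      unfolding Y_def snd_conv
      by (rule DERIV_chain2[OF that DERIV_cong[OF DERIV_diff[OF DERIV_cmult_Id DERIV_const]]]) simp
    have u: "classical_partials u ux uy uyy"
      unfolding classical_partials_def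
    proof (intro conjI allI cont)
      fix x y
      have DXy: "((\<lambda>x. P (X (x, y)) * P (Y (x, y))) has_real_derivative
          P' (X (x, y)) * (1 / h\<^sup>2) * P (Y (x, y))) (at x)"
        using DERIV_cmult_right[OF DX[OF P, where x=x and y=y], where c="P (Y (0, y))"] by (simp add: Y_def)
      show "((\<lambda>x. u (x, y)) has_real_derivative ux (x, y)) (at x)"
        unfolding u_def ux_def
        by (rule DERIV_cong[OF DERIV_cmult[OF DXy]]) (use h(1) in \<open>simp add: power2_eq_square\<close>)
      have DYx: "((\<lambda>y. P (X (x, y)) * f (Y (x, y))) has_real_derivative
          P (X (x, y)) * (f' (Y (x, y)) * (1 / h))) (at y)"
        if "\<And>t. (f has_real_derivative f' t) (at t)" for f f' :: "real \<Rightarrow> real"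
        using DERIV_cmult[OF DY[OF that, where x=x and y=y], where c="P (X (x, 0))"] by (simp add: X_def)
      show "((\<lambda>y. u (x, y)) has_real_derivative uy (x, y)) (at y)"
        unfolding u_def uy_def
        by (rule DERIV_cong[OF DERIV_cmult[OF DYx[OF P]]]) (use h(1) in simp)
      show "((\<lambda>y. uy (x, y)) has_real_derivative uyy (x, y)) (at y)"
        unfolding uy_def uyy_def
        by (rule DERIV_cong[OF DERIV_cmult[OF DYx[OF P']]]) simp
    qed
    have outside: "X z \<notin> {0..1} \<or> Y z \<notin> {0..1}" if "z \<notin> Q" for z
      using that h(1) by (cases z) (auto simp: X_def Y_def Q_def field_simps)
    have zeroQ: "u z = 0" "ux z = 0" "uy z = 0" "uyy z = 0" if "z \<notin> Q" for z
      using outside[OF that] zero by (auto simp: u_def ux_def uy_def uyy_def)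
    have Q: "Q \<in> lmeasurable" "Q \<subseteq> rect L" "measure lebesgue Q = h ^ 3"
      using h by (auto simp: Q_def rect_def content_Pair power_numeral_reduce)
    have "(x, y) \<notin> Q" if "x = 0 \<or> y = 0 \<or> y = 1" for x y
      using that h by (auto simp: Q_def)
    then have adm: "u \<in> Adm1 L"
      by (intro Adm1_if_classical[OF assms(1) u] zeroQ) auto
    note en = classical_energy[OF assms(1) u]
    let ?B = "{z \<in> rect L. 1 \<le> \<bar>uy z\<bar>}"
    have "?B \<subseteq> Q"
      using zeroQ(3) by force
    then have "measure lebesgue ?B \<le> h ^ 3"
      using measure_mono_fmeasurable[of ?B Q lebesgue] Q(1,3) lmeasurable_rect_sublevel(2)[OF cont(3)]
      by (auto simp: fmeasurableD)
    then have B_small: "measure lebesgue (B_set L u) \<le> h ^ 3"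
      using en(1) by simp
    have B_pos: "measure lebesgue ?B > 0"
    proof (rule ccontr)
      assume "\<not> ?thesis"
      then have "measure lebesgue ?B = 0"
        using measure_nonneg[of lebesgue ?B] by linarith
      then have "negligible ?B"
        using negligible_iff_measure lmeasurable_rect_sublevel(2)[OF cont(3)] by blast
      moreover define V where "V = {z. 1 < \<bar>uy z\<bar>} \<inter> interior (rect L)"
      ultimately have "negligible V"
        using interior_subset[of "rect L"] by (intro negligible_subset[of ?B V]) auto
      moreover have "open V"
        unfolding V_def
        by (intro open_Int open_interior open_Collect_less continuous_on_const continuous_on_rabs cont)
      \<comment> \<open>the point where the rescaled profile attains \<open>P s * P' t\<close>, so that its slope is \<open>2\<close>\<close>
      moreover have "(h\<^sup>2 * (1 + s), h * (1 + t)) \<in> V"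
      proof -
        have "s \<in> {0..1}" "t \<in> {0..1}"
          using zero st by blast+
        then have "0 < h\<^sup>2 * (1 + s)" "h\<^sup>2 * (1 + s) \<le> h\<^sup>2 * 2" "0 < h * (1 + t)" "h * (1 + t) \<le> h * 2"
          using h(1) by (auto intro!: mult_left_mono mult_pos_pos)
        then have "0 < h\<^sup>2 * (1 + s)" "h\<^sup>2 * (1 + s) < L" "0 < h * (1 + t)" "h * (1 + t) < 1"
          using h(2,3) by linarith+
        moreover have "uy (h\<^sup>2 * (1 + s), h * (1 + t)) = 2"
          using h(1) st by (simp add: uy_def X_def Y_def c_def)
        ultimately show ?thesis
          by (simp add: V_def interior_rect)
      qed
      ultimately show False
        using open_not_negligible by blast
    qed
    have K: "\<epsilon>\<^sup>2 * (uyy z)\<^sup>2 + (ux z)\<^sup>2 \<le> K / h\<^sup>2" for z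
    proof -
      have *: "(c / h * (a * b))\<^sup>2 \<le> (c * (M * M))\<^sup>2 / h\<^sup>2" if "\<bar>a\<bar> \<le> M" "\<bar>b\<bar> \<le> M" for a b
      proof -
        have "\<bar>c * (a * b)\<bar> \<le> \<bar>c * (M * M)\<bar>"
          using that by (auto simp: abs_mult intro!: mult_mono mult_nonneg_nonneg)
        then have "(c * (a * b))\<^sup>2 \<le> (c * (M * M))\<^sup>2"
          by (simp add: abs_le_square_iff)
        then have "(c * (a * b))\<^sup>2 / h\<^sup>2 \<le> (c * (M * M))\<^sup>2 / h\<^sup>2"
          by (rule divide_right_mono) simp
        then show ?thesis by (simp add: power_divide power_mult_distrib)
      qed
      have "(uyy z)\<^sup>2 \<le> (c * (M * M))\<^sup>2 / h\<^sup>2" "(ux z)\<^sup>2 \<le> (c * (M * M))\<^sup>2 / h\<^sup>2"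
        unfolding uyy_def ux_def by (rule *; use M in blast)+
      then have "\<epsilon>\<^sup>2 * (uyy z)\<^sup>2 + (ux z)\<^sup>2 \<le> \<epsilon>\<^sup>2 * ((c * (M * M))\<^sup>2 / h\<^sup>2) + (c * (M * M))\<^sup>2 / h\<^sup>2"
        by (intro add_mono mult_left_mono) auto
      then show ?thesis
        by (simp add: K_def add_divide_distrib distrib_right)
    qed
    have contf: "continuous_on UNIV (\<lambda>z. \<epsilon>\<^sup>2 * (uyy z)\<^sup>2 + (ux z)\<^sup>2)"
      by (intro continuous_intros cont)
    have "(\<integral>z. \<epsilon>\<^sup>2 * (uyy z)\<^sup>2 + (ux z)\<^sup>2 \<partial>lebesgue_on (rect L))
        = (\<integral>z. (if z \<in> Q then \<epsilon>\<^sup>2 * (uyy z)\<^sup>2 + (ux z)\<^sup>2 else 0) \<partial>lebesgue_on (rect L))"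
      using zeroQ by (intro Bochner_Integration.integral_cong) auto
    also have "\<dots> = (\<integral>z. \<epsilon>\<^sup>2 * (uyy z)\<^sup>2 + (ux z)\<^sup>2 \<partial>lebesgue_on Q)"
      using Q by (intro Lebesgue_Measure.integral_restrict) auto
    also have "\<dots> \<le> (\<integral>z. K / h\<^sup>2 \<partial>lebesgue_on Q)"
    proof (rule integral_mono)
      show "integrable (lebesgue_on Q) (\<lambda>z. \<epsilon>\<^sup>2 * (uyy z)\<^sup>2 + (ux z)\<^sup>2)"
        unfolding Q_def
        by (rule continuous_imp_integrable) (rule continuous_on_subset[OF contf subset_UNIV])
      show "integrable (lebesgue_on Q) (\<lambda>z. K / h\<^sup>2)"
        unfolding Q_def by (rule continuous_imp_integrable) simp
    qed (rule K)
    also have "\<dots> = K * h"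
      using Q h(1) by (simp add: measure_restrict_space power3_eq_cube power2_eq_square)
    finally have elastic: "(\<integral>z. \<epsilon>\<^sup>2 * (uyy z)\<^sup>2 + (ux z)\<^sup>2 \<partial>lebesgue_on (rect L)) \<le> K * h" .
    have "measure lebesgue {z \<in> rect L. \<bar>uy z\<bar> < 1} \<le> measure lebesgue (rect L)"
      by (intro measure_mono_fmeasurable fmeasurableD[OF lmeasurable_rect_sublevel(1)[OF cont(3)]])
        (auto simp: rect_eq_cbox)
    then have "\<Delta> * measure lebesgue {z \<in> rect L. \<bar>uy z\<bar> < 1} \<le> \<Delta> * L"
      using assms by (intro mult_left_mono) (auto simp: measure_rect)
    then have "E1 L \<epsilon> \<Delta> u - E1 L \<epsilon> \<Delta> (\<lambda>z. 0) \<le> K * h"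
      using elastic by (simp add: en(2) E1_zero[OF assms(1)])
    moreover have "u \<in> Adm1_plus L"
      using adm B_pos en(1) by (simp add: Adm1_plus_def)
    ultimately show "\<exists>u\<in>Adm1_plus L. measure lebesgue (B_set L u) \<le> h ^ 3 \<and>
        E1 L \<epsilon> \<Delta> u - E1 L \<epsilon> \<Delta> (\<lambda>z. 0) \<le> K * h"
      using B_small by blast
  qed
qed

text \<open>
  The elastic energy is nonnegative, and relative to the zero function only the points of \<open>B\<close> lower the
  energy, by \<open>\<Delta>\<close> per unit area. Nothing is known about the measurability of the \<open>B\<close>-set of a
  general function; but nonmeasurable sets have measure \<open>0\<close> by convention, so the positivity
  demanded in \<^const>\<open>Adm1_plus\<close> entails measurability.
\<close>

lemma E1_diff_zero_ge:
  assumes "L > 0" "\<Delta> \<ge> 0" "v \<in> Adm1_plus L"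
  shows "- \<Delta> * measure lebesgue (B_set L v) \<le> E1 L \<epsilon> \<Delta> v - E1 L \<epsilon> \<Delta> (\<lambda>z. 0)"
proof -
  have sub: "B_set L v \<subseteq> rect L" by (auto simp: B_set_def)
  have R: "rect L \<in> lmeasurable" by (simp add: rect_eq_cbox)
  have "B_set L v \<in> sets lebesgue"
    using assms(3) measure_notin_sets[of "B_set L v" lebesgue] by (force simp: Adm1_plus_def)
  moreover have "emeasure lebesgue (rect L) \<noteq> \<infinity>"
    using fmeasurableD2[OF R] by simp
  ultimately have A: "measure lebesgue (A_set L v) = measure lebesgue (rect L) - measure lebesgue (B_set L v)"
    unfolding A_set_def
    using sub by (intro measure_Diff fmeasurableD[OF R])
  have "\<Delta> * measure lebesgue (A_set L v) = \<Delta> * L - \<Delta> * measure lebesgue (B_set L v)"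
    by (simp only: A measure_rect[OF assms(1)] right_diff_distrib)
  moreover have "0 \<le> (\<integral>z. \<epsilon>\<^sup>2 * (D_y L (D_y L v) z)\<^sup>2 + (D_x L v z)\<^sup>2 \<partial>lebesgue_on (rect L))"
    by (intro Bochner_Integration.integral_nonneg) simp
  ultimately show ?thesis
    unfolding E1_zero[OF assms(1)] unfolding E1_def by simp
qed

theorem proposition4p1:
  fixes L \<epsilon> \<Delta> :: real
  assumes "L > 0" and "\<epsilon> > 0" and "\<Delta> \<ge> 0"
    and "\<not> zero_minimizes L \<epsilon> \<Delta>"
  shows "Liminf (at_right (0::real))
           (\<lambda>\<mu>. INF v \<in> {v \<in> Adm1_plus L. measure lebesgue (B_set L v) < \<mu>}.
                  ereal (E1 L \<epsilon> \<Delta> v - E1 L \<epsilon> \<Delta> (\<lambda>z. 0))) = 0"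
proof -
  let ?d = "\<lambda>v. ereal (E1 L \<epsilon> \<Delta> v - E1 L \<epsilon> \<Delta> (\<lambda>z. 0))"
  let ?I = "\<lambda>\<mu>. INF v \<in> {v \<in> Adm1_plus L. measure lebesgue (B_set L v) < \<mu>}. ?d v"
  obtain C where C: "\<And>h. 0 < h \<Longrightarrow> 2 * h\<^sup>2 < L \<Longrightarrow> 2 * h < 1 \<Longrightarrow>
    \<exists>u\<in>Adm1_plus L. measure lebesgue (B_set L u) \<le> h ^ 3 \<and>
      E1 L \<epsilon> \<Delta> u - E1 L \<epsilon> \<Delta> (\<lambda>z. 0) \<le> C * h"
    using concentrated_profiles[OF assms(1,3)] by blast
  have lower: "ereal (- \<Delta> * \<mu>) \<le> ?I \<mu>" for \<mu>
  proof (rule INF_greatest)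
    fix v assume v: "v \<in> {v \<in> Adm1_plus L. measure lebesgue (B_set L v) < \<mu>}"
    then have "\<Delta> * measure lebesgue (B_set L v) \<le> \<Delta> * \<mu>"
      using assms(3) by (intro mult_left_mono) auto
    then show "ereal (- \<Delta> * \<mu>) \<le> ?d v"
      using E1_diff_zero_ge[OF assms(1,3), of v \<epsilon>] v by auto
  qed
  have upper: "?I \<mu> \<le> 0" if "\<mu> > 0" for \<mu>
  proof (rule ereal_le_epsilon2)
    fix e :: real assume "e > 0"
    have lim: "((\<lambda>h::real. 2 * h\<^sup>2) \<longlongrightarrow> 0) (at_right 0)" "((\<lambda>h::real. 2 * h) \<longlongrightarrow> 0) (at_right 0)"
      "((\<lambda>h::real. h ^ 3) \<longlongrightarrow> 0) (at_right 0)" "((\<lambda>h::real. C * h) \<longlongrightarrow> 0) (at_right 0)"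
      by (auto intro!: tendsto_eq_intros)
    have "\<forall>\<^sub>F h in at_right 0. (0::real) < h \<and> 2 * h\<^sup>2 < L \<and> 2 * h < 1 \<and> h ^ 3 < \<mu> \<and> C * h < e"
      using order_tendstoD(2)[OF lim(1) assms(1)] order_tendstoD(2)[OF lim(2), of 1]
        order_tendstoD(2)[OF lim(3) that] order_tendstoD(2)[OF lim(4) \<open>e > 0\<close>]
      by (intro eventually_conj eventually_at_right_less) auto
    then obtain h where h: "0 < h" "2 * h\<^sup>2 < L" "2 * h < 1" "h ^ 3 < \<mu>" "C * h < e"
      using eventually_happens'[OF trivial_limit_at_right_real] by blast
    then obtain u where u: "u \<in> Adm1_plus L" "measure lebesgue (B_set L u) \<le> h ^ 3"
      "E1 L \<epsilon> \<Delta> u - E1 L \<epsilon> \<Delta> (\<lambda>z. 0) \<le> C * h"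
      using C by blast
    have "?I \<mu> \<le> ?d u"
      using u h by (intro INF_lower) auto
    also have "\<dots> \<le> ereal e"
      using u(3) h(5) by simp
    finally show "?I \<mu> \<le> 0 + ereal e" by simp
  qed
  \<comment> \<open>The infimum lies between \<open>- \<Delta> * \<mu>\<close> and \<open>0\<close>, so it even converges.\<close>
  have "(?I \<longlongrightarrow> 0) (at_right 0)"
  proof (rule tendsto_sandwich)
    show "\<forall>\<^sub>F \<mu> in at_right 0. ereal (- \<Delta> * \<mu>) \<le> ?I \<mu>"
      by (intro always_eventually allI lower)
    show "\<forall>\<^sub>F \<mu> in at_right 0. ?I \<mu> \<le> 0"
      using eventually_at_right_less by eventually_elim (rule upper)
    have "((\<lambda>\<mu>. - \<Delta> * \<mu>) \<longlongrightarrow> 0) (at_right 0)"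
      by (auto intro!: tendsto_eq_intros)
    then show "((\<lambda>\<mu>. ereal (- \<Delta> * \<mu>)) \<longlongrightarrow> 0) (at_right 0)"
      by (simp add: zero_ereal_def)
  qed simp
  then show ?thesis
    by (intro lim_imp_Liminf) simp_all
qed

end
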